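(* Let $G$ be a reaction network with $s$ species and $m$ reactions, with stoichiometric matrix $\mathcal{N}\in\mathbb{Z}^{s\times m}$, reactant matrix $\mathcal{X}\in\mathbb{Z}^{s\times m}$, and dimension $r:=\operatorname{rank}(\mathcal{N})$. (i) If there is no $\alpha\in\mathbb{R}^m_{>0}$ with $\mathcal{N}\alpha=\mathbf 0$, then $G$ admits no positive steady state for any $\kappa\in\mathbb{R}^m_{>0}$. (ii) Suppose there exists $\alpha\in\mathbb{R}^m_{>0}$ with $\mathcal{N}\alpha=\mathbf 0$. Let $l^{(1)},\dots,l^{(t)}\in\mathbb{R}^m_{\ge0}$ be the extreme rays of the flux cone $\mathcal{F}(\mathcal{N})$, let $\lambda=(\lambda_1,\dots,\lambda_t)$ and $p=(p_1,\dots,p_s)$ be indeterminates, let $$J(p,\lambda):=\mathcal{N}\,\operatorname{diag}\Big(\sum_{i=1}^t\lambda_i l^{(i)}\Big)\,\mathcal{X}^\top\,\operatorname{diag}(p),$$ and let $$B(p,\lambda):=\sum_{I\subseteq\{1,\dots,s\},\ |I|=r}\det\big(J(p,\lambda)[I,I]\big)\in\mathbb{Q}[p,\lambda],$$ where $J[I,I]$ is the principal submatrix with rows and columns indexed by $I$. Then $G$ is degenerate if and only if $B(p,\lambda)$ is the zero polynomial; equivalently, $G$ admits at least one nondegenerate positive steady state (for some $\kappa\in\mathbb{R}^m_{>0}$) if and only if $B(p,\lambda)$ is not the zero polynomial.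
   Context: A reaction network $G$ has species $X_1,\dots,X_s$ and reactions $\mu_{1j}X_1+\dots+\mu_{sj}X_s\xrightarrow{\kappa_j}\nu_{1j}X_1+\dots+\nu_{sj}X_s$, $j=1,\dots,m$, with nonnegative integer coefficients, $(\mu_{1j},\dots,\mu_{sj})\neq(\nu_{1j},\dots,\nu_{sj})$, and rate constants $\kappa_j>0$. The stoichiometric matrix $\mathcal{N}$ has $(i,j)$-entry $\nu_{ij}-\mu_{ij}$; the reactant matrix $\mathcal{X}$ has $(i,j)$-entry $\mu_{ij}$; the stoichiometric subspace $S$ is the column space of $\mathcal{N}$. Under mass-action kinetics the dynamics are $\dot x=f(\kappa,x):=\mathcal{N}v(\kappa,x)$ with $v_j(\kappa,x)=\kappa_j\prod_{i=1}^s x_i^{\mu_{ij}}$. For $\kappa^*\in\mathbb{R}^m_{>0}$, a positive steady state is $x^*\in\mathbb{R}^s_{>0}$ with $f(\kappa^*,x^* )=\mathbf 0$; it is degenerate if the image of the Jacobian $\operatorname{Jac}_f(\kappa^*,x^* )$ restricted to $S$ is not all of $S$. The network $G$ is called degenerate if all of its positive steady states (over all $\kappa\in\mathbb{R}^m_{>0}$) are degenerate, and nondegenerate if it admits at least one nondegenerate positive steady state. The flux cone is $\mathcal{F}(\mathcal{N}):=\{\alpha\in\mathbb{R}^m_{\ge0}:\mathcal{N}\alpha=\mathbf 0\}$. *)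

theory Defs
  imports "HOL-Analysis.Analysis"
begin

text \<open>Species are indexed by a finite type 's, reactions by a finite type 'r.
  mu i j = reactant coefficient, nu i j = product coefficient.\<close>

definition stoich :: "('s::finite \<Rightarrow> 'r::finite \<Rightarrow> nat) \<Rightarrow> ('s \<Rightarrow> 'r \<Rightarrow> nat) \<Rightarrow> 's \<Rightarrow> 'r \<Rightarrow> real" where
  "stoich mu nu i j = real (nu i j) - real (mu i j)"

definition matvec :: "('s::finite \<Rightarrow> 'r::finite \<Rightarrow> real) \<Rightarrow> real^'r \<Rightarrow> real^'s" where
  "matvec M a = (\<chi> i. \<Sum>j\<in>UNIV. M i j * a $ j)"

definition stoich_subspace :: "('s::finite \<Rightarrow> 'r::finite \<Rightarrow> nat) \<Rightarrow> ('s \<Rightarrow> 'r \<Rightarrow> nat) \<Rightarrow> (real^'s) set" where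
  "stoich_subspace mu nu = range (matvec (stoich mu nu))"

definition rate :: "('s::finite \<Rightarrow> 'r::finite \<Rightarrow> nat) \<Rightarrow> real^'r \<Rightarrow> real^'s \<Rightarrow> real^'r" where
  "rate mu \<kappa> x = (\<chi> j. \<kappa> $ j * (\<Prod>i\<in>UNIV. (x $ i) ^ (mu i j)))"

definition mass_action :: "('s::finite \<Rightarrow> 'r::finite \<Rightarrow> nat) \<Rightarrow> ('s \<Rightarrow> 'r \<Rightarrow> nat) \<Rightarrow> real^'r \<Rightarrow> real^'s \<Rightarrow> real^'s" where
  "mass_action mu nu \<kappa> x = matvec (stoich mu nu) (rate mu \<kappa> x)"

definition positive_vec :: "real^'n \<Rightarrow> bool" where
  "positive_vec x \<longleftrightarrow> (\<forall>i. x $ i > 0)"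

definition positive_steady_state :: "('s::finite \<Rightarrow> 'r::finite \<Rightarrow> nat) \<Rightarrow> ('s \<Rightarrow> 'r \<Rightarrow> nat) \<Rightarrow> real^'r \<Rightarrow> real^'s \<Rightarrow> bool" where
  "positive_steady_state mu nu \<kappa> x \<longleftrightarrow> positive_vec x \<and> mass_action mu nu \<kappa> x = 0"

text \<open>The Jacobian of f(kappa, .) at x is its Frechet derivative (a linear map).
  A steady state is degenerate iff the Jacobian does not map S onto S.\<close>
definition degenerate_ss :: "('s::finite \<Rightarrow> 'r::finite \<Rightarrow> nat) \<Rightarrow> ('s \<Rightarrow> 'r \<Rightarrow> nat) \<Rightarrow> real^'r \<Rightarrow> real^'s \<Rightarrow> bool" where
  "degenerate_ss mu nu \<kappa> x \<longleftrightarrow>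
     frechet_derivative (mass_action mu nu \<kappa>) (at x) ` stoich_subspace mu nu \<noteq> stoich_subspace mu nu"

definition network_degenerate :: "('s::finite \<Rightarrow> 'r::finite \<Rightarrow> nat) \<Rightarrow> ('s \<Rightarrow> 'r \<Rightarrow> nat) \<Rightarrow> bool" where
  "network_degenerate mu nu \<longleftrightarrow>
     (\<forall>\<kappa> x. positive_vec \<kappa> \<and> positive_steady_state mu nu \<kappa> x \<longrightarrow> degenerate_ss mu nu \<kappa> x)"

definition network_nondegenerate :: "('s::finite \<Rightarrow> 'r::finite \<Rightarrow> nat) \<Rightarrow> ('s \<Rightarrow> 'r \<Rightarrow> nat) \<Rightarrow> bool" where
  "network_nondegenerate mu nu \<longleftrightarrow>
     (\<exists>\<kappa> x. positive_vec \<kappa> \<and> positive_steady_state mu nu \<kappa> x \<and> \<not> degenerate_ss mu nu \<kappa> x)"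

definition flux_cone :: "('s::finite \<Rightarrow> 'r::finite \<Rightarrow> real) \<Rightarrow> (real^'r) set" where
  "flux_cone N = {\<alpha>. (\<forall>j. \<alpha> $ j \<ge> 0) \<and> matvec N \<alpha> = 0}"

text \<open>l generates an extreme ray of the cone C.\<close>
definition extreme_ray :: "(real^'r) set \<Rightarrow> real^'r \<Rightarrow> bool" where
  "extreme_ray C l \<longleftrightarrow> l \<in> C \<and> l \<noteq> 0 \<and>
     (\<forall>a\<in>C. \<forall>b\<in>C. a + b = l \<longrightarrow> (\<exists>c\<ge>0. a = c *\<^sub>R l))"

text \<open>l 0, ..., l (t-1) is a list of representatives of the extreme rays of C:
  one generator for each extreme ray, no two on the same ray.\<close>
definition extreme_rays_list :: "(real^'r) set \<Rightarrow> nat \<Rightarrow> (nat \<Rightarrow> real^'r) \<Rightarrow> bool" where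
  "extreme_rays_list C t l \<longleftrightarrow>
     (\<forall>i<t. extreme_ray C (l i)) \<and>
     (\<forall>i<t. \<forall>k<t. i \<noteq> k \<longrightarrow> \<not> (\<exists>c>0. l i = c *\<^sub>R l k)) \<and>
     (\<forall>e. extreme_ray C e \<longrightarrow> (\<exists>i<t. \<exists>c>0. e = c *\<^sub>R l i))"

text \<open>J(p,lambda) = N diag(sum_i lambda_i l_i) X^T diag(p), entry (i,k).\<close>
definition Jmat :: "('s::finite \<Rightarrow> 'r::finite \<Rightarrow> nat) \<Rightarrow> ('s \<Rightarrow> 'r \<Rightarrow> nat) \<Rightarrow> nat \<Rightarrow> (nat \<Rightarrow> real^'r)
    \<Rightarrow> real^'s \<Rightarrow> (nat \<Rightarrow> real) \<Rightarrow> 's \<Rightarrow> 's \<Rightarrow> real" where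
  "Jmat mu nu t l p lam i k =
     (\<Sum>j\<in>UNIV. stoich mu nu i j * (\<Sum>a<t. lam a * l a $ j) * real (mu k j)) * p $ k"

text \<open>Determinant of the principal submatrix M[I,I] (Leibniz formula).\<close>
definition principal_minor :: "('s \<Rightarrow> 's \<Rightarrow> real) \<Rightarrow> 's set \<Rightarrow> real" where
  "principal_minor M I = (\<Sum>\<pi>\<in>{\<pi>. \<pi> permutes I}. of_int (sign \<pi>) * (\<Prod>i\<in>I. M i (\<pi> i)))"

definition Bpoly :: "('s::finite \<Rightarrow> 'r::finite \<Rightarrow> nat) \<Rightarrow> ('s \<Rightarrow> 'r \<Rightarrow> nat) \<Rightarrow> nat \<Rightarrow> (nat \<Rightarrow> real^'r)
    \<Rightarrow> real^'s \<Rightarrow> (nat \<Rightarrow> real) \<Rightarrow> real" where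
  "Bpoly mu nu t l p lam =
     (\<Sum>I\<in>{I. card I = dim (stoich_subspace mu nu)}. principal_minor (Jmat mu nu t l p lam) I)"

end

theory Submission
  imports Defs
begin

(* A positive steady state x for rate constants kappa yields the positive flux v(kappa, x) in
   the kernel of N, which gives (i).  At x the Jacobian is N diag(v) X^T diag(1/x), and
   conversely every positive flux alpha and every positive p arise in this way (take x = 1/p
   and kappa_j = alpha_j / x^(X_j)).  Writing the flux as a nonnegative combination
   sum_i lambda_i l^(i) of the extreme rays, nondegeneracy of x becomes B(1/x, lambda) <> 0,
   because a matrix M with range in S maps S onto S iff the sum of its principal minors of
   size dim S is nonzero: in a basis adapted to S that sum is the determinant of M restricted
   to S.  Finally, if B is nonzero somewhere then it is nonzero at a point with p and lambda
   positive, since a polynomial that is nonzero at one point of a line vanishes at only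
   finitely many points of it. *)

section \<open>Sums of principal minors\<close>

definition sum_principal_minors :: "nat \<Rightarrow> ('n \<Rightarrow> 'n \<Rightarrow> real) \<Rightarrow> real" where
  "sum_principal_minors k M = (\<Sum>I | card I = k. principal_minor M I)"

lemma principal_minor_zero_row:
  assumes "finite I" "i \<in> I" "\<And>j. M i j = 0"
  shows "principal_minor M I = 0"
  unfolding principal_minor_def
  using assms by (intro sum.neutral ballI) (auto intro!: prod_zero bexI[of _ i])

lemma det_scalar_plus_expansion:
  fixes A :: "real^'n^'n"
  shows "det (z *\<^sub>R mat 1 + A) =
    (\<Sum>X\<in>Pow UNIV. z ^ card X * principal_minor (\<lambda>i j. A$i$j) (- X))"
proof -
  let ?P = "{\<pi>::'n\<Rightarrow>'n. \<pi> permutes UNIV}"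
  have diag: "(\<Prod>i\<in>X. if \<pi> i = i then z else 0) = (if \<forall>i\<in>X. \<pi> i = i then z ^ card X else 0)"
    for \<pi> and X :: "'n set"
    by auto
  have "det (z *\<^sub>R mat 1 + A) = (\<Sum>\<pi>\<in>?P. of_int (sign \<pi>) *
      (\<Prod>i\<in>UNIV. (if \<pi> i = i then z else 0) + A$i$(\<pi> i)))"
    unfolding det_def by (intro sum.cong refl) (auto simp: mat_def intro!: prod.cong)
  also have "\<dots> = (\<Sum>\<pi>\<in>?P. \<Sum>X\<in>Pow UNIV. of_int (sign \<pi>) *
      ((if \<forall>i\<in>X. \<pi> i = i then z ^ card X else 0) * (\<Prod>i\<in>- X. A$i$(\<pi> i))))"
    by (simp add: prod_add diag sum_distrib_left Compl_eq_Diff_UNIV)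
  also have "\<dots> = (\<Sum>X\<in>Pow UNIV. \<Sum>\<pi>\<in>?P. if \<forall>i\<in>X. \<pi> i = i
      then z ^ card X * (of_int (sign \<pi>) * (\<Prod>i\<in>- X. A$i$(\<pi> i))) else 0)"
    by (subst sum.swap) (auto intro!: sum.cong)
  also have "\<dots> = (\<Sum>X\<in>Pow UNIV. \<Sum>\<pi>\<in>{\<pi>\<in>?P. \<forall>i\<in>X. \<pi> i = i}.
      z ^ card X * (of_int (sign \<pi>) * (\<Prod>i\<in>- X. A$i$(\<pi> i))))"
    by (intro sum.cong refl sum.inter_filter[symmetric]) (simp add: finite_permutations)
  also have "\<dots> = (\<Sum>X\<in>Pow UNIV. z ^ card X * principal_minor (\<lambda>i j. A$i$j) (- X))"
  proof -
    have "{\<pi>\<in>?P. \<forall>i\<in>X. \<pi> i = i} = {\<pi>. \<pi> permutes (- X)}" for X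
      unfolding permutes_def by auto
    then show ?thesis
      by (simp add: principal_minor_def sum_distrib_left)
  qed
  finally show ?thesis .
qed

lemma sum_principal_minors_complement:
  fixes M :: "'n::finite \<Rightarrow> 'n \<Rightarrow> real"
  assumes "n \<le> CARD('n)"
  shows "(\<Sum>X | card X = n. principal_minor M (- X)) = sum_principal_minors (CARD('n) - n) M"
  unfolding sum_principal_minors_def
proof (rule sum.reindex_bij_witness[of _ uminus uminus])
  fix X :: "'n set" assume "X \<in> {X. card X = n}"
  then show "- X \<in> {I. card I = CARD('n) - n}"
    by (simp add: Compl_eq_Diff_UNIV card_Diff_subset)
next
  fix I :: "'n set" assume "I \<in> {I. card I = CARD('n) - n}"
  then show "- I \<in> {X. card X = n}"
    using assms by (simp add: Compl_eq_Diff_UNIV card_Diff_subset)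
qed auto

lemma det_scalar_plus_eq_poly:
  fixes A :: "real^'n^'n"
  shows "det (z *\<^sub>R mat 1 + A) =
    (\<Sum>n\<le>CARD('n). sum_principal_minors (CARD('n) - n) (\<lambda>i j. A$i$j) * z ^ n)"
proof -
  have "det (z *\<^sub>R mat 1 + A) = (\<Sum>n\<le>CARD('n). \<Sum>X\<in>{X\<in>Pow UNIV. card X = n}.
      z ^ card X * principal_minor (\<lambda>i j. A$i$j) (- X))"
    unfolding det_scalar_plus_expansion
    by (rule sum.group[symmetric]) (auto simp: card_mono)
  also have "\<dots> = (\<Sum>n\<le>CARD('n). (\<Sum>X | card X = n. principal_minor (\<lambda>i j. A$i$j) (- X)) * z ^ n)"
    by (auto simp: sum_distrib_right intro!: sum.cong)
  finally show ?thesis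
    by (auto simp: sum_principal_minors_complement intro!: sum.cong)
qed

lemma sum_principal_minors_similar:
  fixes A P Q :: "real^'n^'n"
  assumes QP: "Q ** P = mat 1"
  shows "sum_principal_minors k (\<lambda>i j. (Q ** A ** P)$i$j) = sum_principal_minors k (\<lambda>i j. A$i$j)"
proof (cases "k \<le> CARD('n)")
  case True
  have "(B + C) ** P = B ** P + C ** P" for B C :: "real^'n^'n"
    by (simp add: matrix_matrix_mult_def vec_eq_iff sum.distrib algebra_simps)
  then have "Q ** (z *\<^sub>R mat 1 + A) ** P = z *\<^sub>R mat 1 + Q ** A ** P" for z
    using QP by (simp add: matrix_add_ldistrib matrix_scalar_ac flip: scalar_matrix_assoc)
  then have "det (z *\<^sub>R mat 1 + Q ** A ** P) = det (z *\<^sub>R mat 1 + A)" for z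
    using QP by (metis det_mul det_I mult.commute mult.left_neutral mult.assoc)
  then have "\<forall>n\<le>CARD('n). sum_principal_minors (CARD('n) - n) (\<lambda>i j. (Q ** A ** P)$i$j) =
      sum_principal_minors (CARD('n) - n) (\<lambda>i j. A$i$j)"
    unfolding det_scalar_plus_eq_poly by (subst polyfun_eq_coeffs[symmetric]) auto
  then show ?thesis
    using True by (metis diff_diff_cancel diff_le_self)
next
  case False
  have "card I \<le> CARD('n)" for I :: "'n set"
    by (rule card_mono) auto
  then have "{I :: 'n set. card I = k} = {}"
    using False by auto
  then show ?thesis
    by (simp add: sum_principal_minors_def)
qed

lemma sum_principal_minors_vanishing_rows:
  fixes M :: "'n::finite \<Rightarrow> 'n \<Rightarrow> real"
  assumes "\<And>i j. i \<notin> I \<Longrightarrow> M i j = 0"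
  shows "sum_principal_minors (card I) M = principal_minor M I"
proof -
  have "principal_minor M J = 0" if "card J = card I" "J \<noteq> I" for J
  proof -
    have "\<not> J \<subseteq> I"
      using that card_subset_eq[of I J] by auto
    then obtain i where "i \<in> J" "i \<notin> I" by auto
    then show ?thesis
      using assms by (intro principal_minor_zero_row[of J i]) auto
  qed
  then show ?thesis
    unfolding sum_principal_minors_def by (subst sum.remove[of _ I]) (auto intro: sum.neutral)
qed

definition principal_block :: "('n \<Rightarrow> 'n \<Rightarrow> real) \<Rightarrow> 'n set \<Rightarrow> real^'n^'n" where
  "principal_block M I = (\<chi> i j. if i \<in> I \<and> j \<in> I then M i j else if i = j then 1 else 0)"

lemma det_principal_block:
  fixes M :: "'n::finite \<Rightarrow> 'n \<Rightarrow> real"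
  shows "det (principal_block M I) = principal_minor M I"
proof -
  let ?E = "principal_block M I"
  let ?P = "{\<pi>::'n\<Rightarrow>'n. \<pi> permutes UNIV}"
  have prod_E: "(\<Prod>i\<in>UNIV. ?E$i$(\<pi> i)) = (if \<pi> permutes I then \<Prod>i\<in>I. M i (\<pi> i) else 0)"
    if perm: "\<pi> permutes UNIV" for \<pi>
  proof (cases "\<pi> permutes I")
    case True
    have "(\<Prod>i\<in>UNIV. ?E$i$(\<pi> i)) = (\<Prod>i\<in>UNIV - I. ?E$i$(\<pi> i)) * (\<Prod>i\<in>I. ?E$i$(\<pi> i))"
      by (rule prod.subset_diff) auto
    also have "(\<Prod>i\<in>UNIV - I. ?E$i$(\<pi> i)) = 1"
      using True by (intro prod.neutral) (auto simp: principal_block_def permutes_not_in)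
    also have "(\<Prod>i\<in>I. ?E$i$(\<pi> i)) = (\<Prod>i\<in>I. M i (\<pi> i))"
      using True by (intro prod.cong) (auto simp: principal_block_def permutes_in_image)
    finally show ?thesis
      using True by simp
  next
    case False
    then obtain i where "i \<notin> I" "\<pi> i \<noteq> i"
      using perm unfolding permutes_def by blast
    then have "(\<Prod>i\<in>UNIV. ?E$i$(\<pi> i)) = 0"
      by (intro prod_zero) (auto simp: principal_block_def intro!: bexI[of _ i])
    then show ?thesis
      using False by simp
  qed
  have "det ?E = (\<Sum>\<pi>\<in>?P. if \<pi> permutes I then of_int (sign \<pi>) * (\<Prod>i\<in>I. M i (\<pi> i)) else 0)"
    unfolding det_def by (intro sum.cong refl) (simp add: prod_E)
  also have "\<dots> = (\<Sum>\<pi>\<in>{\<pi>\<in>?P. \<pi> permutes I}. of_int (sign \<pi>) * (\<Prod>i\<in>I. M i (\<pi> i)))"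
    by (rule sum.inter_filter[symmetric]) (simp add: finite_permutations)
  also have "{\<pi>\<in>?P. \<pi> permutes I} = {\<pi>. \<pi> permutes I}"
    by (auto intro: permutes_subset)
  finally show ?thesis
    unfolding principal_minor_def .
qed

definition coordinate_subspace :: "'n set \<Rightarrow> (real^'n) set" where
  "coordinate_subspace I = {x. \<forall>i. i \<notin> I \<longrightarrow> x $ i = 0}"

definition coordinate_proj :: "'n set \<Rightarrow> real^'n \<Rightarrow> real^'n" where
  "coordinate_proj I x = (\<chi> i. if i \<in> I then x $ i else 0)"

lemma coordinate_proj_in_coordinate_subspace: "coordinate_proj I x \<in> coordinate_subspace I"
  by (simp add: coordinate_proj_def coordinate_subspace_def)

lemma principal_block_mult:
  fixes K :: "real^'n^'n"
  assumes K: "\<And>x. K *v x \<in> coordinate_subspace I"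
  shows "principal_block (\<lambda>i j. K$i$j) I *v x = K *v coordinate_proj I x + coordinate_proj (- I) x"
proof -
  let ?E = "principal_block (\<lambda>i j. K$i$j) I"
  have "(?E *v x) $ i = (K *v coordinate_proj I x + coordinate_proj (- I) x) $ i" for i
  proof (cases "i \<in> I")
    case True
    then have "(?E *v x) $ i = (\<Sum>j\<in>UNIV. K$i$j * coordinate_proj I x $ j)"
      by (auto simp: principal_block_def coordinate_proj_def matrix_vector_mult_def intro!: sum.cong)
    then show ?thesis
      using True by (simp add: coordinate_proj_def matrix_vector_mult_def)
  next
    case False
    then have "(?E *v x) $ i = x $ i"
      by (simp add: principal_block_def matrix_vector_mult_def if_distrib[of "\<lambda>a. a * _"] cong: if_cong)
    moreover have "(K *v coordinate_proj I x) $ i = 0"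
      using K False unfolding coordinate_subspace_def by blast
    ultimately show ?thesis
      using False by (simp add: coordinate_proj_def)
  qed
  then show ?thesis
    by (simp add: vec_eq_iff)
qed

lemma surj_principal_block_iff:
  fixes K :: "real^'n^'n"
  assumes K: "\<And>x. K *v x \<in> coordinate_subspace I"
  shows "surj ((*v) (principal_block (\<lambda>i j. K$i$j) I)) \<longleftrightarrow>
    (*v) K ` coordinate_subspace I = coordinate_subspace I"
proof
  assume surj: "surj ((*v) (principal_block (\<lambda>i j. K$i$j) I))"
  have "y \<in> (*v) K ` coordinate_subspace I" if y: "y \<in> coordinate_subspace I" for y
  proof -
    obtain x where x: "y = principal_block (\<lambda>i j. K$i$j) I *v x"
      using surj by (metis surjD)
    have "coordinate_proj (- I) x = 0"
      using y K[of "coordinate_proj I x"] unfolding x principal_block_mult[OF K]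
      by (auto simp: vec_eq_iff coordinate_proj_def coordinate_subspace_def)
    then have "y = K *v coordinate_proj I x"
      unfolding x principal_block_mult[OF K] by simp
    then show ?thesis
      using coordinate_proj_in_coordinate_subspace by blast
  qed
  then show "(*v) K ` coordinate_subspace I = coordinate_subspace I"
    using K by blast
next
  assume eq: "(*v) K ` coordinate_subspace I = coordinate_subspace I"
  have "y \<in> range ((*v) (principal_block (\<lambda>i j. K$i$j) I))" for y
  proof -
    obtain z where z: "z \<in> coordinate_subspace I" "coordinate_proj I y = K *v z"
      using eq coordinate_proj_in_coordinate_subspace[of I y] by (metis imageE)
    have "coordinate_proj I (z + coordinate_proj (- I) y) = z"
      "coordinate_proj (- I) (z + coordinate_proj (- I) y) = coordinate_proj (- I) y"
      using z(1) by (auto simp: coordinate_proj_def coordinate_subspace_def vec_eq_iff)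
    then have "principal_block (\<lambda>i j. K$i$j) I *v (z + coordinate_proj (- I) y) =
        coordinate_proj I y + coordinate_proj (- I) y"
      unfolding principal_block_mult[OF K] z(2) by simp
    also have "\<dots> = y"
      by (simp add: coordinate_proj_def vec_eq_iff)
    finally show ?thesis
      by (metis rangeI)
  qed
  then show "surj ((*v) (principal_block (\<lambda>i j. K$i$j) I))"
    by blast
qed

lemma image_coordinate_subspace_eq_iff_principal_minor:
  fixes K :: "real^'n^'n"
  assumes "\<And>x. K *v x \<in> coordinate_subspace I"
  shows "(*v) K ` coordinate_subspace I = coordinate_subspace I \<longleftrightarrow> principal_minor (\<lambda>i j. K$i$j) I \<noteq> 0"
  using surj_principal_block_iff[OF assms]
  by (simp add: det_principal_block[symmetric] invertible_det_nz[symmetric] invertible_right_inverse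
      matrix_right_invertible_surjective)

lemma image_coordinate_subspace_columns:
  fixes h :: "'n::finite \<Rightarrow> real^'m"
  assumes "inj_on h I"
  shows "(*v) (\<chi> i j. h j $ i) ` coordinate_subspace I = span (h ` I)"
proof -
  have on_subspace: "(\<chi> i j. h j $ i) *v c = (\<Sum>j\<in>I. c$j *\<^sub>R h j)"
    if "c \<in> coordinate_subspace I" for c
  proof -
    have "(\<chi> i j. h j $ i) *v c = (\<Sum>j\<in>UNIV. c$j *\<^sub>R h j)"
      by (simp add: vec_eq_iff matrix_vector_mult_def sum_component mult.commute)
    also have "\<dots> = (\<Sum>j\<in>I. c$j *\<^sub>R h j)"
      using that unfolding coordinate_subspace_def by (intro sum.mono_neutral_right) auto
    finally show ?thesis .
  qed
  show ?thesis
  proof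
    show "(*v) (\<chi> i j. h j $ i) ` coordinate_subspace I \<subseteq> span (h ` I)"
    proof
      fix y assume "y \<in> (*v) (\<chi> i j. h j $ i) ` coordinate_subspace I"
      then obtain c where "c \<in> coordinate_subspace I" "y = (\<chi> i j. h j $ i) *v c"
        by blast
      then have "y = (\<Sum>j\<in>I. c$j *\<^sub>R h j)"
        using on_subspace by simp
      then show "y \<in> span (h ` I)"
        by (simp only:) (intro span_sum span_scale, simp add: span_base)
    qed
  next
    show "span (h ` I) \<subseteq> (*v) (\<chi> i j. h j $ i) ` coordinate_subspace I"
    proof
      fix y assume "y \<in> span (h ` I)"
      then have "y \<in> range (\<lambda>u. \<Sum>v\<in>h ` I. u v *\<^sub>R v)"
        by (simp add: span_finite)
      then obtain u where u: "y = (\<Sum>v\<in>h ` I. u v *\<^sub>R v)"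
        by blast
      define c where "c = (\<chi> j. if j \<in> I then u (h j) else 0)"
      have c: "c \<in> coordinate_subspace I"
        by (simp add: c_def coordinate_subspace_def)
      have "y = (\<Sum>j\<in>I. u (h j) *\<^sub>R h j)"
        unfolding u using assms by (simp add: sum.reindex comp_def)
      also have "\<dots> = (\<Sum>j\<in>I. c$j *\<^sub>R h j)"
        by (simp add: c_def)
      finally have "y = (\<Sum>j\<in>I. c$j *\<^sub>R h j)" .
      then have "y = (\<chi> i j. h j $ i) *v c"
        using on_subspace[OF c] by simp
      then show "y \<in> (*v) (\<chi> i j. h j $ i) ` coordinate_subspace I"
        using c by (rule image_eqI)
    qed
  qed
qed

lemma subspace_eq_image_coordinate_subspace:
  fixes S :: "(real^'n) set"
  assumes "subspace S"
  obtains P Q :: "real^'n^'n" and I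
  where "Q ** P = mat 1" "card I = dim S" "S = (*v) P ` coordinate_subspace I"
proof -
  obtain B where B: "B \<subseteq> S" "independent B" "S \<subseteq> span B" "card B = dim S"
    by (rule basis_exists)
  obtain C where C: "B \<subseteq> C" "independent C" "UNIV \<subseteq> span C"
    using maximal_independent_subset_extend[of B UNIV] B(2) by auto
  have "finite C" "card C = CARD('n)"
    using C basis_card_eq_dim[of C UNIV] by (auto intro: finiteI_independent)
  then obtain h where h: "bij_betw h (UNIV :: 'n set) C"
    using finite_same_card_bij[of "UNIV :: 'n set" C] by auto
  define P :: "real^'n^'n" where "P = (\<chi> i j. h j $ i)"
  define I where "I = h -` B"
  have inj: "inj h" and hI: "h ` I = B"
    using h C(1) by (auto simp: I_def bij_betw_def)
  have "(*v) P ` UNIV = UNIV"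
    using image_coordinate_subspace_columns[of h UNIV] inj h C(3)
    by (auto simp: P_def coordinate_subspace_def bij_betw_def)
  then obtain Q where "P ** Q = mat 1"
    using matrix_right_invertible_surjective by blast
  moreover have "card I = dim S"
    using B(4) hI inj card_image[of h I] by (metis inj_on_subset subset_UNIV)
  moreover have "S = (*v) P ` coordinate_subspace I"
    using image_coordinate_subspace_columns[of h I] inj hI span_subspace[OF B(1,3) assms]
    by (simp add: P_def inj_on_subset)
  ultimately show ?thesis
    using that matrix_left_right_inverse by blast
qed

lemma matrix_image_subspace_eq_iff_sum_principal_minors:
  fixes M :: "real^'n^'n"
  assumes S: "subspace S" and MS: "\<And>x. M *v x \<in> S"
  shows "(*v) M ` S = S \<longleftrightarrow> sum_principal_minors (dim S) (\<lambda>i j. M$i$j) \<noteq> 0"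
proof -
  obtain P Q :: "real^'n^'n" and I where QP: "Q ** P = mat 1" and I: "card I = dim S"
    and S_eq: "S = (*v) P ` coordinate_subspace I"
    using subspace_eq_image_coordinate_subspace[OF S] .
  have PQ: "P ** Q = mat 1"
    using QP matrix_left_right_inverse by blast
  define K where "K = Q ** M ** P"
  have "P ** K = M ** P"
    by (metis K_def PQ matrix_mul_assoc matrix_mul_lid)
  then have PK: "P *v (K *v x) = M *v (P *v x)" for x
    by (simp add: matrix_vector_mul_assoc)
  have K_into: "K *v x \<in> coordinate_subspace I" for x
  proof -
    obtain c where "c \<in> coordinate_subspace I" "M *v (P *v x) = P *v c"
      using MS[of "P *v x"] unfolding S_eq by blast
    moreover have "K *v x = Q *v (M *v (P *v x))"
      by (simp add: K_def matrix_vector_mul_assoc matrix_mul_assoc)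
    ultimately show ?thesis
      using QP by (simp add: matrix_vector_mul_assoc)
  qed
  have K_rows: "K$i$j = 0" if "i \<notin> I" for i j
    using K_into[of "axis j 1"] that
    by (simp add: coordinate_subspace_def matrix_vector_mult_basis column_def)
  have "inj ((*v) P)"
    using QP by (metis inj_on_inverseI matrix_vector_mul_assoc matrix_vector_mul_lid)
  moreover have "(*v) M ` S = (*v) P ` ((*v) K ` coordinate_subspace I)"
    unfolding S_eq image_image PK ..
  ultimately have "(*v) M ` S = S \<longleftrightarrow> (*v) K ` coordinate_subspace I = coordinate_subspace I"
    unfolding S_eq by (simp add: inj_image_eq_iff)
  also have "\<dots> \<longleftrightarrow> principal_minor (\<lambda>i j. K$i$j) I \<noteq> 0"
    using K_into by (rule image_coordinate_subspace_eq_iff_principal_minor)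
  also have "principal_minor (\<lambda>i j. K$i$j) I = sum_principal_minors (dim S) (\<lambda>i j. K$i$j)"
    unfolding I[symmetric] using K_rows by (simp add: sum_principal_minors_vanishing_rows)
  also have "\<dots> = sum_principal_minors (dim S) (\<lambda>i j. M$i$j)"
    unfolding K_def using QP by (rule sum_principal_minors_similar)
  finally show ?thesis .
qed

section \<open>Extreme rays of the flux cone\<close>

lemma matvec_eq_matrix_vector_mult: "matvec N = (*v) (\<chi> i j. N i j)"
  by (simp add: fun_eq_iff matvec_def matrix_vector_mult_def)

lemma linear_matvec: "linear (matvec N)"
  by (simp add: matvec_eq_matrix_vector_mult matrix_vector_mul_linear)

definition support :: "real^'n \<Rightarrow> 'n set" where
  "support x = {j. x $ j \<noteq> 0}"

lemma flux_cone_subtract_within_support: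
  assumes \<beta>: "\<beta> \<in> flux_cone N" and \<delta>: "\<delta> \<in> flux_cone N" "\<delta> \<noteq> 0"
    and sub: "support \<delta> \<subseteq> support \<beta>"
  shows "\<exists>\<theta>>0. \<beta> - \<theta> *\<^sub>R \<delta> \<in> flux_cone N \<and> support (\<beta> - \<theta> *\<^sub>R \<delta>) \<subset> support \<beta>"
proof -
  let ?D = "support \<delta>"
  have pos: "\<beta>$j > 0" "\<delta>$j > 0" if "j \<in> ?D" for j
    using that sub \<beta> \<delta>(1) unfolding support_def flux_cone_def by (auto simp: order.order_iff_strict)
  have "?D \<noteq> {}"
    using \<delta>(2) by (auto simp: support_def vec_eq_iff)
  define \<theta> where "\<theta> = Min ((\<lambda>j. \<beta>$j / \<delta>$j) ` ?D)"
  have "\<theta> \<in> (\<lambda>j. \<beta>$j / \<delta>$j) ` ?D"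
    unfolding \<theta>_def using \<open>?D \<noteq> {}\<close> by (intro Min_in) auto
  then obtain j0 where j0: "j0 \<in> ?D" "\<theta> = \<beta>$j0 / \<delta>$j0"
    by blast
  have "\<theta> * \<delta>$j \<le> \<beta>$j" if "j \<in> ?D" for j
  proof -
    have "\<theta> \<le> \<beta>$j / \<delta>$j"
      unfolding \<theta>_def using that by (intro Min_le) auto
    then show ?thesis
      using pos(2)[OF that] by (simp add: field_simps)
  qed
  then have "(\<beta> - \<theta> *\<^sub>R \<delta>)$j \<ge> 0" for j
    using \<beta> by (cases "j \<in> ?D") (auto simp: support_def flux_cone_def)
  moreover have "matvec N (\<beta> - \<theta> *\<^sub>R \<delta>) = 0"
    using \<beta> \<delta> linear_matvec[of N] by (simp add: flux_cone_def linear_diff linear_cmul)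
  moreover have "support (\<beta> - \<theta> *\<^sub>R \<delta>) \<subset> support \<beta>"
  proof -
    have "support (\<beta> - \<theta> *\<^sub>R \<delta>) \<subseteq> support \<beta>"
      using sub by (auto simp: support_def)
    moreover have "(\<beta> - \<theta> *\<^sub>R \<delta>)$j0 = 0"
      using j0 pos(2)[OF j0(1)] by simp
    ultimately show ?thesis
      using sub j0(1) unfolding support_def by blast
  qed
  moreover have "\<theta> > 0"
    using j0 pos by simp
  ultimately show ?thesis
    by (auto simp: flux_cone_def)
qed

lemma extreme_ray_if_support_minimal:
  assumes \<beta>: "\<beta> \<in> flux_cone N" "\<beta> \<noteq> 0"
    and minimal: "\<not> (\<exists>\<delta>\<in>flux_cone N. \<delta> \<noteq> 0 \<and> support \<delta> \<subset> support \<beta>)"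
  shows "extreme_ray (flux_cone N) \<beta>"
  unfolding extreme_ray_def
proof (intro conjI ballI impI \<beta>)
  fix a b assume a: "a \<in> flux_cone N" and b: "b \<in> flux_cone N" and ab: "a + b = \<beta>"
  show "\<exists>c\<ge>0. a = c *\<^sub>R \<beta>"
  proof (cases "a = 0")
    case True
    then show ?thesis by auto
  next
    case False
    have "a$j + b$j = \<beta>$j" "a$j \<ge> 0" "b$j \<ge> 0" for j
      using a b ab unfolding flux_cone_def by auto
    then have "support a \<subseteq> support \<beta>"
      unfolding support_def by (smt (verit) mem_Collect_eq subsetI)
    then obtain \<theta> where \<theta>: "\<theta> > 0" "\<beta> - \<theta> *\<^sub>R a \<in> flux_cone N" "support (\<beta> - \<theta> *\<^sub>R a) \<subset> support \<beta>"
      using flux_cone_subtract_within_support[OF \<beta>(1) a False] by blast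
    then have "\<beta> - \<theta> *\<^sub>R a = 0"
      using minimal by blast
    then have "a = (1 / \<theta>) *\<^sub>R \<beta>"
      using \<theta>(1) by (simp add: vec_eq_iff field_simps)
    then show ?thesis
      using \<theta>(1) by (intro exI[of _ "1 / \<theta>"]) simp
  qed
qed

lemma flux_cone_eq_extreme_ray_combination:
  assumes rays: "extreme_rays_list (flux_cone N) t l" and "\<beta> \<in> flux_cone N"
  shows "\<exists>c. (\<forall>a<t. c a \<ge> 0) \<and> \<beta> = (\<Sum>a<t. c a *\<^sub>R l a)"
  using \<open>\<beta> \<in> flux_cone N\<close>
proof (induction "card (support \<beta>)" arbitrary: \<beta> rule: less_induct)
  case less
  show ?case
  proof (cases "\<exists>\<delta>\<in>flux_cone N. \<delta> \<noteq> 0 \<and> support \<delta> \<subset> support \<beta>")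
    case True
    then obtain \<delta> where \<delta>: "\<delta> \<in> flux_cone N" "\<delta> \<noteq> 0" "support \<delta> \<subset> support \<beta>"
      by blast
    obtain \<theta> where \<theta>: "\<theta> > 0" "\<beta> - \<theta> *\<^sub>R \<delta> \<in> flux_cone N" "support (\<beta> - \<theta> *\<^sub>R \<delta>) \<subset> support \<beta>"
      using flux_cone_subtract_within_support[OF less.prems \<delta>(1,2)] \<delta>(3) by auto
    obtain c1 where c1: "\<forall>a<t. c1 a \<ge> 0" "\<delta> = (\<Sum>a<t. c1 a *\<^sub>R l a)"
      using less.hyps[OF psubset_card_mono[OF finite \<delta>(3)] \<delta>(1)] by blast
    obtain c2 where c2: "\<forall>a<t. c2 a \<ge> 0" "\<beta> - \<theta> *\<^sub>R \<delta> = (\<Sum>a<t. c2 a *\<^sub>R l a)"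
      using less.hyps[OF psubset_card_mono[OF finite \<theta>(3)] \<theta>(2)] by blast
    have "\<beta> = (\<beta> - \<theta> *\<^sub>R \<delta>) + \<theta> *\<^sub>R \<delta>"
      by simp
    also have "\<dots> = (\<Sum>a<t. (c2 a + \<theta> * c1 a) *\<^sub>R l a)"
      by (subst c2(2)) (simp add: c1(2) scaleR_sum_right sum.distrib scaleR_add_left)
    finally show ?thesis
      using c1(1) c2(1) \<theta>(1) by (intro exI[of _ "\<lambda>a. c2 a + \<theta> * c1 a"]) auto
  next
    case False
    show ?thesis
    proof (cases "\<beta> = 0")
      case True
      then show ?thesis
        by (intro exI[of _ "\<lambda>_. 0"]) simp
    next
      case nonzero: False
      then have "extreme_ray (flux_cone N) \<beta>"
        using extreme_ray_if_support_minimal[OF less.prems] False by blast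
      then obtain i d where "i < t" "d > 0" "\<beta> = d *\<^sub>R l i"
        using rays unfolding extreme_rays_list_def by blast
      then show ?thesis
        by (intro exI[of _ "\<lambda>a. if a = i then d else 0"])
          (simp add: if_distrib[of "\<lambda>x. x *\<^sub>R _"] cong: if_cong)
    qed
  qed
qed

section \<open>The Jacobian of mass-action kinetics\<close>

(* The matrix N diag(alpha) X^T diag(p). *)
definition convex_jacobian :: "('s::finite \<Rightarrow> 'r::finite \<Rightarrow> nat) \<Rightarrow> ('s \<Rightarrow> 'r \<Rightarrow> nat) \<Rightarrow> real^'r \<Rightarrow> real^'s \<Rightarrow> 's \<Rightarrow> 's \<Rightarrow> real" where
  "convex_jacobian mu nu \<alpha> p i k = (\<Sum>j\<in>UNIV. stoich mu nu i j * \<alpha>$j * real (mu k j)) * p$k"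

lemma matvec_convex_jacobian:
  "matvec (convex_jacobian mu nu \<alpha> p) h =
     matvec (stoich mu nu) (\<chi> j. \<alpha>$j * (\<Sum>k\<in>UNIV. real (mu k j) * p$k * h$k))"
proof -
  have "(\<Sum>k\<in>UNIV. (\<Sum>j\<in>UNIV. stoich mu nu i j * \<alpha>$j * real (mu k j)) * p$k * h$k) =
      (\<Sum>k\<in>UNIV. \<Sum>j\<in>UNIV. stoich mu nu i j * (\<alpha>$j * (real (mu k j) * p$k * h$k)))" for i
    by (simp add: sum_distrib_left sum_distrib_right mult_ac)
  also have "\<dots> i = (\<Sum>j\<in>UNIV. stoich mu nu i j * (\<alpha>$j * (\<Sum>k\<in>UNIV. real (mu k j) * p$k * h$k)))" for i
    by (subst sum.swap) (simp add: sum_distrib_left)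
  finally show ?thesis
    by (simp add: matvec_def convex_jacobian_def vec_eq_iff)
qed

lemma monomial_has_derivative:
  fixes x :: "real^'n::finite"
  assumes nonzero: "\<And>l. x$l \<noteq> 0"
  shows "((\<lambda>y. \<Prod>l\<in>UNIV. (y$l) ^ m l) has_derivative
     (\<lambda>h. (\<Prod>l\<in>UNIV. (x$l) ^ m l) * (\<Sum>l\<in>UNIV. real (m l) * h$l / x$l))) (at x)"
proof -
  have deriv: "((\<lambda>y. \<Prod>l\<in>UNIV. (y$l) ^ m l) has_derivative
      (\<lambda>h. \<Sum>l\<in>UNIV. real (m l) * h$l * (x$l) ^ (m l - 1) * (\<Prod>l'\<in>UNIV - {l}. (x$l') ^ m l'))) (at x)"
    by (intro has_derivative_prod has_derivative_power bounded_linear.has_derivative[OF bounded_linear_vec_nth has_derivative_ident])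
  have "real (m l) * c * (x$l) ^ (m l - 1) * (\<Prod>l'\<in>UNIV - {l}. (x$l') ^ m l') =
      (\<Prod>l\<in>UNIV. (x$l) ^ m l) * (real (m l) * c / x$l)" for l c
  proof (cases "m l = 0")
    case False
    then have "(\<Prod>l\<in>UNIV. (x$l) ^ m l) = x$l * (x$l) ^ (m l - 1) * (\<Prod>l'\<in>UNIV - {l}. (x$l') ^ m l')"
      by (simp add: prod.remove[of UNIV l] power_eq_if)
    then show ?thesis
      using nonzero[of l] by (simp add: field_simps)
  qed simp
  then show ?thesis
    by (intro has_derivative_eq_rhs[OF deriv]) (simp add: fun_eq_iff sum_distrib_left)
qed

lemma mass_action_eq_column_sum:
  "mass_action mu nu \<kappa> =
     (\<lambda>y. \<Sum>j\<in>UNIV. (\<kappa>$j * (\<Prod>l\<in>UNIV. (y$l) ^ mu l j)) *\<^sub>R (\<chi> i. stoich mu nu i j))"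
  by (simp add: fun_eq_iff vec_eq_iff mass_action_def matvec_def rate_def sum_component mult.commute)

lemma mass_action_has_derivative:
  assumes nonzero: "\<And>k. x$k \<noteq> 0"
  shows "(mass_action mu nu \<kappa> has_derivative
     matvec (convex_jacobian mu nu (rate mu \<kappa> x) (\<chi> k. 1 / x$k))) (at x)"
proof -
  have "(mass_action mu nu \<kappa> has_derivative (\<lambda>h. \<Sum>j\<in>UNIV. (\<kappa>$j * ((\<Prod>l\<in>UNIV. (x$l) ^ mu l j) *
      (\<Sum>k\<in>UNIV. real (mu k j) * h$k / x$k))) *\<^sub>R (\<chi> i. stoich mu nu i j))) (at x)"
    unfolding mass_action_eq_column_sum
    by (intro has_derivative_sum has_derivative_scaleR_left has_derivative_mult_right
        monomial_has_derivative nonzero)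
  moreover have "(\<Sum>j\<in>UNIV. (\<kappa>$j * ((\<Prod>l\<in>UNIV. (x$l) ^ mu l j) *
      (\<Sum>k\<in>UNIV. real (mu k j) * h$k / x$k))) *\<^sub>R (\<chi> i. stoich mu nu i j)) =
    matvec (convex_jacobian mu nu (rate mu \<kappa> x) (\<chi> k. 1 / x$k)) h" for h
    unfolding matvec_convex_jacobian
    by (simp add: vec_eq_iff matvec_def rate_def sum_component mult_ac)
  ultimately show ?thesis
    by (simp add: fun_eq_iff)
qed

lemma subspace_stoich_subspace: "subspace (stoich_subspace mu nu)"
  unfolding stoich_subspace_def using linear_matvec subspace_UNIV by (rule linear_subspace_image)

lemma degenerate_ss_iff_sum_principal_minors:
  assumes "\<And>k. x$k \<noteq> 0"
  shows "degenerate_ss mu nu \<kappa> x \<longleftrightarrow>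
    sum_principal_minors (dim (stoich_subspace mu nu)) (convex_jacobian mu nu (rate mu \<kappa> x) (\<chi> k. 1 / x$k)) = 0"
proof -
  let ?J = "convex_jacobian mu nu (rate mu \<kappa> x) (\<chi> k. 1 / x$k)"
  have "frechet_derivative (mass_action mu nu \<kappa>) (at x) = matvec ?J"
    by (rule frechet_derivative_at[OF mass_action_has_derivative[OF assms], symmetric])
  then have D: "frechet_derivative (mass_action mu nu \<kappa>) (at x) = (*v) (\<chi> i j. ?J i j)"
    by (simp add: matvec_eq_matrix_vector_mult)
  have "(\<chi> i j. ?J i j) *v h \<in> stoich_subspace mu nu" for h
    unfolding matvec_eq_matrix_vector_mult[symmetric] matvec_convex_jacobian
    by (simp add: stoich_subspace_def)
  from matrix_image_subspace_eq_iff_sum_principal_minors[OF subspace_stoich_subspace this]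
  show ?thesis
    unfolding degenerate_ss_def D by simp
qed

lemma Bpoly_eq_sum_principal_minors:
  "Bpoly mu nu t l p lam =
     sum_principal_minors (dim (stoich_subspace mu nu)) (convex_jacobian mu nu (\<Sum>a<t. lam a *\<^sub>R l a) p)"
proof -
  have "Jmat mu nu t l p lam = convex_jacobian mu nu (\<Sum>a<t. lam a *\<^sub>R l a) p"
    by (simp add: fun_eq_iff Jmat_def convex_jacobian_def sum_component)
  then show ?thesis
    by (simp add: Bpoly_def sum_principal_minors_def)
qed

section \<open>Nondegenerate steady states\<close>

lemma rate_positive:
  assumes "positive_vec \<kappa>" "positive_vec x"
  shows "positive_vec (rate mu \<kappa> x)"
  using assms unfolding positive_vec_def rate_def by (auto intro!: mult_pos_pos prod_pos)

lemma rate_constants_realizing_flux: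
  assumes \<alpha>: "positive_vec \<alpha>" and x: "positive_vec x"
  shows "\<exists>\<kappa>. positive_vec \<kappa> \<and> rate mu \<kappa> x = \<alpha>"
proof -
  have monomial_pos: "(\<Prod>i\<in>UNIV. (x$i) ^ mu i j) > 0" for j
    using x unfolding positive_vec_def by (intro prod_pos) simp
  define \<kappa> where "\<kappa> = (\<chi> j. \<alpha>$j / (\<Prod>i\<in>UNIV. (x$i) ^ mu i j))"
  have "positive_vec \<kappa>"
    using \<alpha> monomial_pos unfolding positive_vec_def \<kappa>_def by simp
  moreover have "rate mu \<kappa> x = \<alpha>"
    using monomial_pos unfolding rate_def \<kappa>_def vec_eq_iff by (simp add: less_imp_neq[symmetric])
  ultimately show ?thesis
    by blast
qed

lemma real_polynomial_function_nonzero_near_zero: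
  fixes g :: "real \<Rightarrow> real"
  assumes "real_polynomial_function g" "g c \<noteq> 0" "\<delta> > 0"
  shows "\<exists>u. 0 < u \<and> u < \<delta> \<and> g u \<noteq> 0"
proof -
  obtain a n where g: "g = (\<lambda>x. \<Sum>i\<le>n. a i * x ^ i)"
    using assms(1) real_polynomial_function_iff_sum by blast
  have "\<exists>i\<le>n. a i \<noteq> 0"
  proof (rule ccontr)
    assume "\<not> (\<exists>i\<le>n. a i \<noteq> 0)"
    then have "g c = 0"
      unfolding g by simp
    then show False
      using assms(2) by blast
  qed
  then have "finite {x. g x = 0}"
    unfolding g by (rule polyfun_finite_roots[THEN iffD2])
  then have "infinite ({0<..<\<delta>} - {x. g x = 0})"
    using assms(3) by (intro Diff_infinite_finite) auto
  then obtain u where "u \<in> {0<..<\<delta>} - {x. g x = 0}"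
    by (metis finite.emptyI ex_in_conv)
  then show ?thesis
    by auto
qed

lemma real_polynomial_function_Bpoly_segment:
  "real_polynomial_function (\<lambda>u. Bpoly mu nu t l (\<chi> k. 1 + u * (p0$k - 1)) (\<lambda>a. 1 + u * (lam0 a - 1)))"
  unfolding Bpoly_def principal_minor_def Jmat_def vec_lambda_beta
  by (intro real_polynomial_function_sum real_polynomial_function_prod real_polynomial_function.intros
      bounded_linear_ident) (auto intro: finite_permutations)

lemma Bpoly_nonzero_at_positive_point:
  assumes "Bpoly mu nu t l p0 lam0 \<noteq> 0"
  shows "\<exists>p lam. positive_vec p \<and> (\<forall>a<t. lam a > 0) \<and> Bpoly mu nu t l p lam \<noteq> 0"
proof -
  (* On the segment from (1, ..., 1) to (p0, lam0), B is a polynomial in the parameter u that is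
     nonzero at u = 1, hence at some small u > 0, where all coordinates are still positive. *)
  define bound where "bound = 1 + (\<Sum>k\<in>UNIV. \<bar>p0$k - 1\<bar>) + (\<Sum>a<t. \<bar>lam0 a - 1\<bar>)"
  have sums_nonneg: "(\<Sum>k\<in>UNIV. \<bar>p0$k - 1\<bar>) \<ge> 0" "(\<Sum>a<t. \<bar>lam0 a - 1\<bar>) \<ge> 0"
    by (simp_all add: sum_nonneg)
  then have "bound \<ge> 1"
    unfolding bound_def by simp
  have "\<exists>u. 0 < u \<and> u < 1 / bound \<and>
      Bpoly mu nu t l (\<chi> k. 1 + u * (p0$k - 1)) (\<lambda>a. 1 + u * (lam0 a - 1)) \<noteq> 0"
    using assms \<open>bound \<ge> 1\<close>
    by (intro real_polynomial_function_nonzero_near_zero[OF real_polynomial_function_Bpoly_segment,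
          where c = 1]) simp_all
  then obtain u where u: "0 < u" "u < 1 / bound"
    and nonzero: "Bpoly mu nu t l (\<chi> k. 1 + u * (p0$k - 1)) (\<lambda>a. 1 + u * (lam0 a - 1)) \<noteq> 0"
    by blast
  have "u * bound < 1"
    using u \<open>bound \<ge> 1\<close> by (simp add: field_simps)
  have positive: "1 + u * d > 0" if "\<bar>d\<bar> \<le> bound" for d
  proof -
    have "u * (- bound) \<le> u * d"
      using u(1) that by (intro mult_left_mono) auto
    then show ?thesis
      using \<open>u * bound < 1\<close> by simp
  qed
  have "\<bar>p0$k - 1\<bar> \<le> bound" for k
  proof -
    have "\<bar>p0$k - 1\<bar> \<le> (\<Sum>k\<in>UNIV. \<bar>p0$k - 1\<bar>)"
      by (rule member_le_sum) auto
    then show ?thesis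
      using sums_nonneg unfolding bound_def by linarith
  qed
  moreover have "\<bar>lam0 a - 1\<bar> \<le> bound" if "a < t" for a
  proof -
    have "\<bar>lam0 a - 1\<bar> \<le> (\<Sum>a<t. \<bar>lam0 a - 1\<bar>)"
      using that by (intro member_le_sum) auto
    then show ?thesis
      using sums_nonneg unfolding bound_def by linarith
  qed
  ultimately show ?thesis
    using nonzero positive unfolding positive_vec_def by (intro exI conjI) auto
qed

lemma positive_extreme_ray_combination:
  assumes rays: "extreme_rays_list (flux_cone N) t l"
    and \<alpha>0: "positive_vec \<alpha>0" "matvec N \<alpha>0 = 0"
    and lam: "\<forall>a<t. lam a > 0"
  shows "positive_vec (\<Sum>a<t. lam a *\<^sub>R l a)"
  unfolding positive_vec_def
proof
  fix j
  have l_nonneg: "l a $ j \<ge> 0" if "a < t" for a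
    using rays that unfolding extreme_rays_list_def extreme_ray_def flux_cone_def by auto
  have "\<alpha>0 \<in> flux_cone N"
    using \<alpha>0 unfolding flux_cone_def positive_vec_def by (auto intro: less_imp_le)
  then obtain c where c: "\<forall>a<t. c a \<ge> 0" "\<alpha>0 = (\<Sum>a<t. c a *\<^sub>R l a)"
    using flux_cone_eq_extreme_ray_combination[OF rays] by blast
  have "\<exists>a<t. l a $ j > 0"
  proof (rule ccontr)
    assume "\<not> (\<exists>a<t. l a $ j > 0)"
    then have "\<forall>a<t. l a $ j = 0"
      using l_nonneg by (metis not_less order.antisym)
    then have "\<alpha>0 $ j = 0"
      unfolding c(2) by simp
    then show False
      using \<alpha>0(1) unfolding positive_vec_def by (metis less_irrefl)
  qed
  then obtain a where a: "a < t" "l a $ j > 0"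
    by blast
  have "0 < lam a * l a $ j"
    using a lam by simp
  also have "\<dots> \<le> (\<Sum>a<t. lam a * l a $ j)"
    using a lam l_nonneg by (intro member_le_sum) (auto intro: less_imp_le)
  finally show "(\<Sum>a<t. lam a *\<^sub>R l a) $ j > 0"
    by simp
qed

lemma no_positive_steady_state_without_positive_flux:
  assumes "\<nexists>\<alpha>. positive_vec \<alpha> \<and> matvec (stoich mu nu) \<alpha> = 0"
  shows "\<nexists>\<kappa> x. positive_vec \<kappa> \<and> positive_steady_state mu nu \<kappa> x"
  using assms rate_positive
  unfolding positive_steady_state_def mass_action_def by blast

lemma Bpoly_nonzero_if_nondegenerate:
  assumes rays: "extreme_rays_list (flux_cone (stoich mu nu)) t l"
    and "network_nondegenerate mu nu"
  shows "\<exists>p lam. Bpoly mu nu t l p lam \<noteq> 0"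
proof -
  obtain \<kappa> x where \<kappa>: "positive_vec \<kappa>" and x: "positive_vec x"
    and steady: "mass_action mu nu \<kappa> x = 0" and nondegenerate: "\<not> degenerate_ss mu nu \<kappa> x"
    using assms(2) unfolding network_nondegenerate_def positive_steady_state_def by blast
  have "rate mu \<kappa> x \<in> flux_cone (stoich mu nu)"
    using rate_positive[OF \<kappa> x] steady
    unfolding flux_cone_def positive_vec_def mass_action_def by (auto intro: less_imp_le)
  then obtain c where "rate mu \<kappa> x = (\<Sum>a<t. c a *\<^sub>R l a)"
    using flux_cone_eq_extreme_ray_combination[OF rays] by blast
  moreover have "\<And>k. x$k \<noteq> 0"
    using x unfolding positive_vec_def by (metis less_irrefl)
  ultimately have "Bpoly mu nu t l (\<chi> k. 1 / x$k) c \<noteq> 0"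
    using nondegenerate by (simp add: Bpoly_eq_sum_principal_minors degenerate_ss_iff_sum_principal_minors)
  then show ?thesis
    by blast
qed

lemma nondegenerate_if_Bpoly_nonzero:
  assumes rays: "extreme_rays_list (flux_cone (stoich mu nu)) t l"
    and \<alpha>0: "positive_vec \<alpha>0" "matvec (stoich mu nu) \<alpha>0 = 0"
    and "Bpoly mu nu t l p0 lam0 \<noteq> 0"
  shows "network_nondegenerate mu nu"
proof -
  obtain p lam where p: "positive_vec p" and lam: "\<forall>a<t. lam a > 0"
    and nonzero: "Bpoly mu nu t l p lam \<noteq> 0"
    using Bpoly_nonzero_at_positive_point[OF assms(4)] by blast
  define \<alpha> where "\<alpha> = (\<Sum>a<t. lam a *\<^sub>R l a)"
  have \<alpha>_pos: "positive_vec \<alpha>"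
    unfolding \<alpha>_def using positive_extreme_ray_combination[OF rays \<alpha>0 lam] .
  have "matvec (stoich mu nu) \<alpha> = 0"
    using rays linear_matvec[of "stoich mu nu"]
    by (simp add: \<alpha>_def linear_sum linear_cmul extreme_rays_list_def extreme_ray_def flux_cone_def)
  define x where "x = (\<chi> k. 1 / p$k)"
  have x: "positive_vec x" and "(\<chi> k. 1 / x$k) = p" and "\<And>k. x$k \<noteq> 0"
    using p by (auto simp: positive_vec_def x_def vec_eq_iff) (metis less_irrefl)
  obtain \<kappa> where \<kappa>: "positive_vec \<kappa>" and rate: "rate mu \<kappa> x = \<alpha>"
    using rate_constants_realizing_flux[OF \<alpha>_pos x] by blast
  have "positive_steady_state mu nu \<kappa> x"
    using x \<open>matvec (stoich mu nu) \<alpha> = 0\<close> rate by (simp add: positive_steady_state_def mass_action_def)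
  moreover have "\<not> degenerate_ss mu nu \<kappa> x"
    using nonzero \<open>\<And>k. x$k \<noteq> 0\<close> \<open>(\<chi> k. 1 / x$k) = p\<close> rate
    by (simp add: degenerate_ss_iff_sum_principal_minors Bpoly_eq_sum_principal_minors \<alpha>_def)
  ultimately show ?thesis
    using \<kappa> unfolding network_nondegenerate_def by blast
qed

theorem theorem1:
  fixes mu nu :: "'s::finite \<Rightarrow> 'r::finite \<Rightarrow> nat"
  assumes distinct_sides: "\<forall>j. (\<lambda>i. mu i j) \<noteq> (\<lambda>i. nu i j)"
  shows "((\<nexists>\<alpha>. positive_vec \<alpha> \<and> matvec (stoich mu nu) \<alpha> = 0) \<longrightarrow>
           (\<nexists>\<kappa> x. positive_vec \<kappa> \<and> positive_steady_state mu nu \<kappa> x))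
       \<and> (\<forall>t l. (\<exists>\<alpha>. positive_vec \<alpha> \<and> matvec (stoich mu nu) \<alpha> = 0) \<and>
                extreme_rays_list (flux_cone (stoich mu nu)) t l \<longrightarrow>
            (network_degenerate mu nu \<longleftrightarrow> (\<forall>p lam. Bpoly mu nu t l p lam = 0)) \<and>
            (network_nondegenerate mu nu \<longleftrightarrow> (\<exists>p lam. Bpoly mu nu t l p lam \<noteq> 0)))"
proof (intro conjI impI allI)
  show "\<nexists>\<kappa> x. positive_vec \<kappa> \<and> positive_steady_state mu nu \<kappa> x"
    if "\<nexists>\<alpha>. positive_vec \<alpha> \<and> matvec (stoich mu nu) \<alpha> = 0"
    using that by (rule no_positive_steady_state_without_positive_flux)
next
  fix t l
  assume "(\<exists>\<alpha>. positive_vec \<alpha> \<and> matvec (stoich mu nu) \<alpha> = 0) \<and>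
    extreme_rays_list (flux_cone (stoich mu nu)) t l"
  then obtain \<alpha>0 where \<alpha>0: "positive_vec \<alpha>0" "matvec (stoich mu nu) \<alpha>0 = 0"
    and rays: "extreme_rays_list (flux_cone (stoich mu nu)) t l"
    by blast
  show nondegenerate_iff: "network_nondegenerate mu nu \<longleftrightarrow> (\<exists>p lam. Bpoly mu nu t l p lam \<noteq> 0)"
    using Bpoly_nonzero_if_nondegenerate[OF rays] nondegenerate_if_Bpoly_nonzero[OF rays \<alpha>0] by blast
  have "network_degenerate mu nu \<longleftrightarrow> \<not> network_nondegenerate mu nu"
    unfolding network_nondegenerate_def network_degenerate_def by blast
  then show "network_degenerate mu nu \<longleftrightarrow> (\<forall>p lam. Bpoly mu nu t l p lam = 0)"
    using nondegenerate_iff by blast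
qed

end
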